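(* Every regular real number is superspeedable; in particular, every strongly left-computable number is superspeedable.
   Context: For $A\subseteq\mathbb{N}$ let $x_A:=\sum_{n\in A}2^{-(n+1)}$. A real $x\in[0,1]$ is strongly left-computable if $x=x_A$ for some computably enumerable set $A\subseteq\mathbb{N}$. A real number is regular if it can be written as a finite sum of strongly left-computable numbers. A left-approximation of $x$ is a computable increasing sequence $(x_n)_n$ of rationals converging to $x$; $x$ is superspeedable if it has a left-approximation with $\limsup_{n\to\infty}\frac{x_{n+1}-x_n}{x-x_n}=1$. *)

theory Defs
  imports "HOL-Analysis.Analysis"
begin

text \<open>
  Total recursive functions: \<open>total_recursive n f\<close> says that \<open>f\<close>, restricted to lists of
  length \<open>n\<close>, is an \<open>n\<close>-ary general recursive function. Minimisation is only applied to
  regular functions, so every member of the class is total. Values of \<open>f\<close> on lists of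
  another length are irrelevant.
\<close>

inductive total_recursive :: "nat \<Rightarrow> (nat list \<Rightarrow> nat) \<Rightarrow> bool" where
  zero: "total_recursive n (\<lambda>xs. 0)"
| succ: "total_recursive 1 (\<lambda>xs. Suc (xs ! 0))"
| proj: "i < n \<Longrightarrow> total_recursive n (\<lambda>xs. xs ! i)"
| comp: "total_recursive (length gs) f \<Longrightarrow> (\<And>g. g \<in> set gs \<Longrightarrow> total_recursive n g) \<Longrightarrow>
    total_recursive n (\<lambda>xs. f (map (\<lambda>g. g xs) gs))"
| prim_rec: "total_recursive n f \<Longrightarrow> total_recursive (Suc (Suc n)) g \<Longrightarrow>
    total_recursive (Suc n)
      (\<lambda>xs. rec_nat (f (tl xs)) (\<lambda>k r. g (k # r # tl xs)) (hd xs))"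
| minimisation: "total_recursive (Suc n) f \<Longrightarrow>
    (\<And>xs. length xs = n \<Longrightarrow> \<exists>k. f (k # xs) = 0) \<Longrightarrow>
    total_recursive n (\<lambda>xs. LEAST k. f (k # xs) = 0)"

definition computable :: "(nat \<Rightarrow> nat) \<Rightarrow> bool" where
  "computable h \<longleftrightarrow> (\<exists>f. total_recursive 1 f \<and> (\<forall>n. h n = f [n]))"

definition computably_enumerable :: "nat set \<Rightarrow> bool" where
  "computably_enumerable A \<longleftrightarrow> A = {} \<or> (\<exists>h. computable h \<and> A = range h)"

definition computable_rat_seq :: "(nat \<Rightarrow> rat) \<Rightarrow> bool" where
  "computable_rat_seq q \<longleftrightarrow>
     (\<exists>s a b. computable s \<and> computable a \<and> computable b \<and>
        (\<forall>n. b n \<noteq> 0 \<and> q n = (- 1) ^ s n * (of_nat (a n) / of_nat (b n))))"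

definition real_of_set :: "nat set \<Rightarrow> real" where
  "real_of_set A = (\<Sum>\<^sub>\<infinity>n\<in>A. 1 / 2 ^ (n + 1))"

definition strongly_left_computable :: "real \<Rightarrow> bool" where
  "strongly_left_computable x \<longleftrightarrow>
     x \<in> {0..1} \<and> (\<exists>A. computably_enumerable A \<and> x = real_of_set A)"

definition regular :: "real \<Rightarrow> bool" where
  "regular x \<longleftrightarrow>
     (\<exists>(k::nat) y. (\<forall>i<k. strongly_left_computable (y i)) \<and> x = (\<Sum>i<k. y i))"

text \<open>
  Increasing means strictly increasing, so all terms lie strictly below the limit and the
  quotients in the definition of superspeedability have nonzero denominators.
\<close>

definition left_approximation :: "(nat \<Rightarrow> rat) \<Rightarrow> real \<Rightarrow> bool" where
  "left_approximation q x \<longleftrightarrow>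
     computable_rat_seq q \<and> strict_mono q \<and> (\<lambda>n. real_of_rat (q n)) \<longlonglongrightarrow> x"

definition superspeedable :: "real \<Rightarrow> bool" where
  "superspeedable x \<longleftrightarrow>
     (\<exists>q. left_approximation q x \<and>
        limsup (\<lambda>n. ereal ((real_of_rat (q (Suc n)) - real_of_rat (q n)) /
                           (x - real_of_rat (q n)))) = 1)"

end

theory Submission imports Defs begin

text \<open>
  A regular real is a sum of terms \<open>2 ^ -(u i)\<close> with \<open>u\<close> computable and every value taken at
  most \<open>k\<close> times, or else it is rational. Suppose that the partial sums do not already witness
  superspeedability. Then from some stage on, every jump leaves a remainder of comparable size, so
  the values of \<open>u\<close> still to come after a stage \<open>s\<close> have gaps of length at most some
  fixed \<open>m\<close>, counted from their minimum. Hence, if a value below \<open>n\<close> is still to come,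
  more than \<open>n / m\<close> indices with values below \<open>2n\<close> are missing. Knowing the limit superior
  of the (bounded) quotients \<open>card {i. u i < 2n} / n\<close> up to an error of \<open>1 / m\<close>, one can
  therefore find infinitely many pairs \<open>(n, s)\<close> such that all values below \<open>n\<close> have
  appeared before stage \<open>s\<close>. So the real is computable, and a subsequence of the partial sums
  can be chosen whose every jump is almost the whole remaining distance.
\<close>

section \<open>Closure properties of recursive functions\<close>

text \<open>\<open>total_recursive n\<close> is not extensional on lists of length \<open>n\<close>; this closure is.\<close>

definition recursive_fn :: "nat \<Rightarrow> (nat list \<Rightarrow> nat) \<Rightarrow> bool" where
  "recursive_fn n f \<longleftrightarrow> (\<exists>f'. total_recursive n f' \<and> (\<forall>xs. length xs = n \<longrightarrow> f xs = f' xs))"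

text \<open>Truth is coded by \<open>0\<close> because minimisation searches for a zero.\<close>

definition decidable :: "nat \<Rightarrow> (nat list \<Rightarrow> bool) \<Rightarrow> bool" where
  "decidable n P \<longleftrightarrow> recursive_fn n (\<lambda>xs. if P xs then 0 else 1)"

named_theorems recursive_intros

lemma recursive_fnI: "total_recursive n f \<Longrightarrow> recursive_fn n f"
  by (auto simp: recursive_fn_def)

lemma recursive_fn_cong:
  assumes "\<And>xs. length xs = n \<Longrightarrow> f xs = g xs"
  shows "recursive_fn n f \<longleftrightarrow> recursive_fn n g"
  using assms by (auto simp: recursive_fn_def)

lemma decidable_cong:
  assumes "\<And>xs. length xs = n \<Longrightarrow> P xs \<longleftrightarrow> Q xs"
  shows "decidable n P \<longleftrightarrow> decidable n Q"
  unfolding decidable_def by (rule recursive_fn_cong) (simp add: assms)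

lemma computable_iff: "computable h \<longleftrightarrow> recursive_fn 1 (\<lambda>xs. h (xs ! 0))"
proof
  assume "computable h"
  then obtain f where f: "total_recursive 1 f" "\<And>n. h n = f [n]"
    by (auto simp: computable_def)
  show "recursive_fn 1 (\<lambda>xs. h (xs ! 0))"
    unfolding recursive_fn_def
  proof (intro exI conjI allI impI)
    fix xs :: "nat list" assume "length xs = 1"
    then have "xs = [xs ! 0]" by (simp add: list_eq_iff_nth_eq)
    then show "h (xs ! 0) = f xs" using f(2) by metis
  qed (rule f)
next
  assume "recursive_fn 1 (\<lambda>xs. h (xs ! 0))"
  then obtain f where "total_recursive 1 f" "\<And>xs. length xs = 1 \<Longrightarrow> h (xs ! 0) = f xs"
    by (auto simp: recursive_fn_def)
  then show "computable h"
    unfolding computable_def by (intro exI[of _ f]) (metis One_nat_def length_Cons list.size(3) nth_Cons_0)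
qed

text \<open>Each inner function is replaced by a genuine \<open>total_recursive\<close>
  representative agreeing with it on lists of length \<open>n\<close>; \<open>G\<close> chooses
  these simultaneously.\<close>

lemma recursive_fn_comp:
  assumes "recursive_fn (length gs) f" "\<And>g. g \<in> set gs \<Longrightarrow> recursive_fn n g"
  shows "recursive_fn n (\<lambda>xs. f (map (\<lambda>g. g xs) gs))"
proof -
  obtain f' where f': "total_recursive (length gs) f'"
      "\<And>xs. length xs = length gs \<Longrightarrow> f xs = f' xs"
    using assms(1) by (auto simp: recursive_fn_def)
  have "\<forall>g\<in>set gs. \<exists>g'. total_recursive n g' \<and> (\<forall>xs. length xs = n \<longrightarrow> g xs = g' xs)"
    using assms(2) by (auto simp: recursive_fn_def)
  then obtain G where G: "\<And>g. g \<in> set gs \<Longrightarrow> total_recursive n (G g)"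
      "\<And>g xs. g \<in> set gs \<Longrightarrow> length xs = n \<Longrightarrow> g xs = G g xs"
    by metis
  have "total_recursive n (\<lambda>xs. f' (map (\<lambda>g. g xs) (map G gs)))"
    by (rule total_recursive.comp) (use f' G in auto)
  moreover have "f (map (\<lambda>g. g xs) gs) = f' (map (\<lambda>g. g xs) (map G gs))" if "length xs = n" for xs
  proof -
    have "map (\<lambda>g. g xs) gs = map (\<lambda>g. g xs) (map G gs)"
      using G(2) that by auto
    then show ?thesis by (metis f'(2) length_map)
  qed
  ultimately show ?thesis by (auto simp: recursive_fn_def)
qed

lemma recursive_fn_nth [recursive_intros]: "i < n \<Longrightarrow> recursive_fn n (\<lambda>xs. xs ! i)"
  by (intro recursive_fnI total_recursive.proj)

lemma recursive_fn_tl_nth [recursive_intros]: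
  assumes "Suc i < n" shows "recursive_fn n (\<lambda>xs. tl xs ! i)"
proof -
  have "recursive_fn n (\<lambda>xs. tl xs ! i) \<longleftrightarrow> recursive_fn n (\<lambda>xs. xs ! Suc i)"
    by (rule recursive_fn_cong) (use assms in \<open>auto simp: nth_tl\<close>)
  then show ?thesis using assms by (simp add: recursive_fn_nth)
qed

lemma recursive_fn_comp1:
  assumes "computable f" "recursive_fn n g"
  shows "recursive_fn n (\<lambda>xs. f (g xs))"
  using recursive_fn_comp[of "[g]" "\<lambda>xs. f (xs ! 0)" n] assms by (simp add: computable_iff)

lemma recursive_fn_comp2:
  assumes "recursive_fn 2 (\<lambda>xs. f (xs ! 0) (xs ! 1))" "recursive_fn n g" "recursive_fn n h"
  shows "recursive_fn n (\<lambda>xs. f (g xs) (h xs))"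
  using recursive_fn_comp[of "[g, h]" "\<lambda>xs. f (xs ! 0) (xs ! 1)" n] assms
  by (auto simp: numeral_2_eq_2)

lemma computable_Suc: "computable Suc"
  unfolding computable_iff by (intro recursive_fnI total_recursive.succ)

lemmas recursive_fn_Suc [recursive_intros] = recursive_fn_comp1[OF computable_Suc]

lemma recursive_fn_const [recursive_intros]: "recursive_fn n (\<lambda>xs. c)"
proof (induction c)
  case 0
  show ?case by (intro recursive_fnI total_recursive.zero)
qed (rule recursive_fn_Suc)

text \<open>Composing with \<open>c\<close> and all projections puts a computed value in front of
  the unchanged parameters. This lets a recursion run up to a computed bound and not only up to an
  argument.\<close>

lemma recursive_fn_cons:
  assumes "recursive_fn (Suc n) (\<lambda>ys. f (hd ys) (tl ys))" "recursive_fn n c"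
  shows "recursive_fn n (\<lambda>xs. f (c xs) xs)"
proof -
  define gs where "gs = c # map (\<lambda>i xs. xs ! i) [0..<n]"
  have "recursive_fn n (\<lambda>xs. f (hd (map (\<lambda>g. g xs) gs)) (tl (map (\<lambda>g. g xs) gs)))"
    by (rule recursive_fn_comp) (use assms in \<open>auto simp: gs_def intro: recursive_fn_nth\<close>)
  moreover have "map (\<lambda>g. g xs) gs = c xs # xs" if "length xs = n" for xs
    using that by (auto simp: gs_def intro: nth_equalityI)
  ultimately show ?thesis
    by (subst recursive_fn_cong[where g = "\<lambda>xs. f (hd (map (\<lambda>g. g xs) gs)) (tl (map (\<lambda>g. g xs) gs))"]) auto
qed

lemma recursive_fn_rec_nat:
  assumes "recursive_fn n f" "recursive_fn (Suc (Suc n)) (\<lambda>ys. g (ys ! 0) (ys ! 1) (tl (tl ys)))"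
    and "recursive_fn n c"
  shows "recursive_fn n (\<lambda>xs. rec_nat (f xs) (\<lambda>k r. g k r xs) (c xs))"
proof -
  obtain f' where f': "total_recursive n f'" "\<And>xs. length xs = n \<Longrightarrow> f xs = f' xs"
    using assms(1) by (auto simp: recursive_fn_def)
  obtain g' where g': "total_recursive (Suc (Suc n)) g'"
      "\<And>ys. length ys = Suc (Suc n) \<Longrightarrow> g (ys ! 0) (ys ! 1) (tl (tl ys)) = g' ys"
    using assms(2) by (auto simp: recursive_fn_def)
  have g'': "g k r xs = g' (k # r # xs)" if "length xs = n" for k r xs
    using g'(2)[of "k # r # xs"] that by simp
  have "recursive_fn (Suc n) (\<lambda>xs. rec_nat (f' (tl xs)) (\<lambda>k r. g' (k # r # tl xs)) (hd xs))"
    by (intro recursive_fnI total_recursive.prim_rec f' g')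
  then have "recursive_fn n (\<lambda>xs. rec_nat (f' xs) (\<lambda>k r. g' (k # r # xs)) (c xs))"
    using assms(3) by (rule recursive_fn_cons)
  then show ?thesis
    by (subst recursive_fn_cong[where g = "\<lambda>xs. rec_nat (f' xs) (\<lambda>k r. g' (k # r # xs)) (c xs)"])
       (simp_all add: f' g'')
qed

section \<open>Arithmetic and iteration\<close>

lemma recursive_fn_add [recursive_intros]:
  assumes "recursive_fn n f" "recursive_fn n g"
  shows "recursive_fn n (\<lambda>xs. f xs + g xs)"
proof -
  have "rec_nat a (\<lambda>k r. Suc r) b = a + b" for a b :: nat
    by (induction b) auto
  moreover have "recursive_fn n (\<lambda>xs. rec_nat (f xs) (\<lambda>k r. Suc r) (g xs))"
    by (intro recursive_fn_rec_nat recursive_intros assms) simp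
  ultimately show ?thesis by simp
qed

lemma recursive_fn_sum [recursive_intros]:
  assumes "recursive_fn (Suc n) (\<lambda>ys. f (ys ! 0) (tl ys))" "recursive_fn n c"
  shows "recursive_fn n (\<lambda>xs. \<Sum>i<c xs. f i xs)"
proof -
  \<comment> \<open>A recursion step receives \<open>k # r # xs\<close>, so the summand is reindexed
    by projections that skip the accumulator \<open>r\<close>.\<close>
  have f: "recursive_fn (Suc (Suc n)) (\<lambda>ys. f (ys ! 0) (tl (tl ys)))"
  proof -
    define gs :: "(nat list \<Rightarrow> nat) list"
      where "gs = (\<lambda>xs. xs ! 0) # map (\<lambda>i xs. tl (tl xs) ! i) [0..<n]"
    have tt: "recursive_fn (Suc (Suc n)) (\<lambda>xs. tl (tl xs) ! i)" if "i < n" for i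
    proof -
      have "recursive_fn (Suc (Suc n)) (\<lambda>xs. tl (tl xs) ! i) \<longleftrightarrow>
          recursive_fn (Suc (Suc n)) (\<lambda>xs. xs ! Suc (Suc i))"
        by (rule recursive_fn_cong) (use that in \<open>auto simp: nth_tl\<close>)
      then show ?thesis using that by (simp add: recursive_fn_nth)
    qed
    have "recursive_fn (Suc (Suc n)) (\<lambda>xs. f (map (\<lambda>g. g xs) gs ! 0) (tl (map (\<lambda>g. g xs) gs)))"
      by (rule recursive_fn_comp) (use assms tt in \<open>auto simp: gs_def intro: recursive_fn_nth\<close>)
    moreover have "map (\<lambda>g. g xs) gs = xs ! 0 # tl (tl xs)" if "length xs = Suc (Suc n)" for xs
      using that by (auto simp: gs_def intro!: nth_equalityI)
    ultimately show ?thesis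
      by (subst recursive_fn_cong
          [where g = "\<lambda>xs. f (map (\<lambda>g. g xs) gs ! 0) (tl (map (\<lambda>g. g xs) gs))"]) auto
  qed
  have "rec_nat 0 (\<lambda>k r. r + f k xs) b = (\<Sum>i<b. f i xs)" for xs b
    by (induction b) auto
  moreover have "recursive_fn n (\<lambda>xs. rec_nat 0 (\<lambda>k r. r + f k xs) (c xs))"
    by (intro recursive_fn_rec_nat recursive_intros assms f) simp
  ultimately show ?thesis by simp
qed

lemma recursive_fn_mult [recursive_intros]:
  assumes "recursive_fn n f" "recursive_fn n g"
  shows "recursive_fn n (\<lambda>xs. f xs * g xs)"
proof -
  have "recursive_fn 2 (\<lambda>xs. \<Sum>i<xs ! 0. xs ! 1)"
    by (intro recursive_intros) simp_all
  then have "recursive_fn 2 (\<lambda>xs. xs ! 0 * xs ! 1)" by simp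
  from recursive_fn_comp2[of "(*)", OF this assms] show ?thesis .
qed

lemma computable_iterate:
  assumes "computable f" shows "computable (\<lambda>n. (f ^^ n) c)"
proof -
  have "rec_nat c (\<lambda>k r. f r) n = (f ^^ n) c" for n by (induction n) auto
  moreover have "recursive_fn 1 (\<lambda>xs. rec_nat c (\<lambda>k r. f r) (xs ! 0))"
    by (intro recursive_fn_rec_nat recursive_intros recursive_fn_comp1[OF assms]) simp_all
  ultimately show ?thesis by (simp add: computable_iff)
qed

lemma computable_pred: "computable (\<lambda>n. n - 1)"
proof -
  have "rec_nat 0 (\<lambda>k r. k) n = n - 1" for n by (cases n) auto
  moreover have "recursive_fn 1 (\<lambda>xs. rec_nat 0 (\<lambda>k r. k) (xs ! 0))"
    by (intro recursive_fn_rec_nat recursive_intros) simp_all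
  ultimately show ?thesis by (simp add: computable_iff)
qed

lemma recursive_fn_diff [recursive_intros]:
  assumes "recursive_fn n f" "recursive_fn n g"
  shows "recursive_fn n (\<lambda>xs. f xs - g xs)"
proof -
  have "rec_nat a (\<lambda>k r. r - 1) b = a - b" for a b :: nat
    by (induction b) auto
  moreover have "recursive_fn n (\<lambda>xs. rec_nat (f xs) (\<lambda>k r. r - 1) (g xs))"
    by (intro recursive_fn_rec_nat recursive_intros recursive_fn_comp1[OF computable_pred] assms) simp
  ultimately show ?thesis by simp
qed

lemma recursive_fn_power_const [recursive_intros]:
  assumes "recursive_fn n f"
  shows "recursive_fn n (\<lambda>xs. c ^ f xs)"
proof -
  have "computable (\<lambda>n. ((\<lambda>m. c * m) ^^ n) 1)"
    by (intro computable_iterate) (unfold computable_iff, intro recursive_intros, simp)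
  moreover have "((\<lambda>m. c * m) ^^ n) 1 = c ^ n" for n by (induction n) auto
  ultimately have "computable (\<lambda>n. c ^ n)" by simp
  from recursive_fn_comp1[OF this assms] show ?thesis .
qed

lemma recursive_fn_If [recursive_intros]:
  assumes "decidable n P" "recursive_fn n f" "recursive_fn n g"
  shows "recursive_fn n (\<lambda>xs. if P xs then f xs else g xs)"
proof -
  have "(\<lambda>xs. if P xs then f xs else g xs) =
      (\<lambda>xs. (1 - (if P xs then 0 else 1)) * f xs + (if P xs then 0 else 1) * g xs)"
    by auto
  moreover have "recursive_fn n \<dots>"
    by (intro recursive_intros assms[unfolded decidable_def])
  ultimately show ?thesis by (simp only: decidable_def)
qed

section \<open>Decidable predicates and search\<close>

lemma decidable_le [recursive_intros]:
  assumes "recursive_fn n f" "recursive_fn n g"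
  shows "decidable n (\<lambda>xs. f xs \<le> g xs)"
proof -
  have "(\<lambda>xs. if f xs \<le> g xs then 0 else 1) = (\<lambda>xs. 1 - (Suc (g xs) - f xs))"
    by auto
  moreover have "recursive_fn n \<dots>"
    by (intro recursive_intros assms[unfolded decidable_def])
  ultimately show ?thesis by (simp only: decidable_def)
qed

lemma decidable_less [recursive_intros]:
  assumes "recursive_fn n f" "recursive_fn n g"
  shows "decidable n (\<lambda>xs. f xs < g xs)"
  unfolding less_eq_Suc_le by (intro recursive_intros assms)

lemma decidable_conj [recursive_intros]:
  assumes "decidable n P" "decidable n Q"
  shows "decidable n (\<lambda>xs. P xs \<and> Q xs)"
proof -
  have "(\<lambda>xs. if P xs \<and> Q xs then 0 else 1 :: nat) =
      (\<lambda>xs. if P xs then (if Q xs then 0 else 1) else 1)"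
    by auto
  moreover have "recursive_fn n \<dots>"
    by (intro recursive_intros assms assms[unfolded decidable_def])
  ultimately show ?thesis unfolding decidable_def by metis
qed

lemma decidable_eq [recursive_intros]:
  assumes "recursive_fn n f" "recursive_fn n g"
  shows "decidable n (\<lambda>xs. f xs = g xs)"
  using decidable_conj[OF decidable_le[OF assms] decidable_le[OF assms(2,1)]]
  by (simp add: eq_iff)

text \<open>Counting the witnesses below the bound turns the quantifier into a comparison with a
  recursive sum.\<close>

lemma decidable_bex [recursive_intros]:
  assumes "decidable (Suc n) (\<lambda>ys. P (ys ! 0) (tl ys))" "recursive_fn n c"
  shows "decidable n (\<lambda>xs. \<exists>i<c xs. P i xs)"
proof -
  have "(\<exists>i<c xs. P i xs) \<longleftrightarrow> 1 \<le> (\<Sum>i<c xs. if P i xs then 1 else 0 :: nat)" for xs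
    by (auto simp: Suc_le_eq zero_less_iff_neq_zero simp del: neq0_conv)
  moreover have "decidable n (\<lambda>xs. 1 \<le> (\<Sum>i<c xs. if P i xs then 1 else 0 :: nat))"
    by (intro recursive_intros assms)
  ultimately show ?thesis by simp
qed

lemma recursive_fn_Least [recursive_intros]:
  assumes "decidable (Suc n) (\<lambda>ys. P (ys ! 0) (tl ys))" "\<And>xs. length xs = n \<Longrightarrow> \<exists>k. P k xs"
  shows "recursive_fn n (\<lambda>xs. LEAST k. P k xs)"
proof -
  obtain f where f: "total_recursive (Suc n) f"
      "\<And>ys. length ys = Suc n \<Longrightarrow> (if P (ys ! 0) (tl ys) then 0 else 1) = f ys"
    using assms(1) by (auto simp: decidable_def recursive_fn_def)
  have eq: "f (k # xs) = 0 \<longleftrightarrow> P k xs" if "length xs = n" for k xs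
    using f(2)[of "k # xs"] that by (auto split: if_splits)
  have "total_recursive n (\<lambda>xs. LEAST k. f (k # xs) = 0)"
    by (rule total_recursive.minimisation) (use f eq assms(2) in auto)
  then show ?thesis unfolding recursive_fn_def using eq by auto
qed

lemma computable_Least:
  assumes "decidable 2 (\<lambda>ys. P (ys ! 0) (ys ! 1))" "\<And>n. \<exists>k. P k n"
  shows "computable (\<lambda>n. LEAST k. P k n)"
proof -
  have "decidable 2 (\<lambda>ys. P (ys ! 0) (tl ys ! 0)) \<longleftrightarrow> decidable 2 (\<lambda>ys. P (ys ! 0) (ys ! 1))"
    by (rule decidable_cong) (simp add: nth_tl)
  then show ?thesis unfolding computable_iff
    by (intro recursive_fn_Least) (use assms in \<open>simp_all add: numeral_2_eq_2\<close>)
qed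

text \<open>Halving decodes the interleaving of two enumerations in \<open>coded_add\<close>; it is
  obtained by unbounded search.\<close>

lemma computable_div2: "computable (\<lambda>n. n div 2)"
proof -
  have "(LEAST k. n < 2 * k + 2) = n div 2" for n :: nat
    by (rule Least_equality) auto
  moreover have "computable (\<lambda>n. LEAST k. n < 2 * k + 2)"
    by (rule computable_Least) (intro recursive_intros, simp_all, presburger)
  ultimately show ?thesis by simp
qed

section \<open>Regular reals as dyadic series with bounded multiplicities\<close>

text \<open>
  The value \<open>0\<close> of \<open>h\<close> means that nothing is enumerated at that step. It makes the coding
  uniform for finite and infinite sets and stable under interleaving.
\<close>

definition weight :: "nat \<Rightarrow> real" where
  "weight n = (if n = 0 then 0 else (1/2) ^ n)"

text \<open>The bound \<open>k\<close> allows different summands to repeat an exponent, which makes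
  the notion stable under addition. The value \<open>0\<close> is exempt, since padding may occur
  infinitely often. Finiteness is demanded separately because \<open>card\<close> of an infinite set
  is \<open>0\<close>.\<close>

definition coded :: "real \<Rightarrow> bool" where
  "coded x \<longleftrightarrow> (\<exists>h k. computable h \<and>
     (\<forall>n>0. finite {i. h i = n} \<and> card {i. h i = n} \<le> k) \<and>
     ((\<lambda>i. weight (h i)) has_sum x) UNIV)"

lemma coded_0: "coded 0"
  unfolding coded_def
proof (intro exI conjI)
  show "computable (\<lambda>i. 0)" unfolding computable_iff by (intro recursive_intros)
qed (auto simp: weight_def)

text \<open>Even positions run the first enumeration and odd positions the second. Each fibre is
  then a union of images of two fibres, so the multiplicity bounds add.\<close>

lemma coded_add:
  assumes "coded x" "coded y" shows "coded (x + y)"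
proof -
  obtain f k where f: "computable f" "\<And>n. n > 0 \<Longrightarrow> finite {i. f i = n} \<and> card {i. f i = n} \<le> k"
      "((\<lambda>i. weight (f i)) has_sum x) UNIV"
    using assms(1) by (auto simp: coded_def)
  obtain g l where g: "computable g" "\<And>n. n > 0 \<Longrightarrow> finite {i. g i = n} \<and> card {i. g i = n} \<le> l"
      "((\<lambda>i. weight (g i)) has_sum y) UNIV"
    using assms(2) by (auto simp: coded_def)
  define h where "h = (\<lambda>n. if 2 * (n div 2) = n then f (n div 2) else g (n div 2))"
  have h_even [simp]: "h (2 * n) = f n" and h_odd [simp]: "h (Suc (2 * n)) = g n" for n
    by (auto simp: h_def)
  have UNIV_eq: "range (\<lambda>n. 2 * n) \<union> range (\<lambda>n. Suc (2 * n)) = (UNIV :: nat set)"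
    by (auto, metis evenE oddE Suc_eq_plus1 rangeI)
  have h_eq: "{i. h i = n} = (\<lambda>n. 2 * n) ` {i. f i = n} \<union> (\<lambda>n. Suc (2 * n)) ` {i. g i = n}" for n
  proof -
    have "{i. h i = n} = {i \<in> range (\<lambda>n. 2 * n) \<union> range (\<lambda>n. Suc (2 * n)). h i = n}"
      unfolding UNIV_eq by simp
    also have "\<dots> = (\<lambda>n. 2 * n) ` {i. f i = n} \<union> (\<lambda>n. Suc (2 * n)) ` {i. g i = n}"
      by auto
    finally show ?thesis .
  qed
  have "computable h"
    unfolding computable_iff h_def
    by (intro recursive_intros recursive_fn_comp1[OF computable_div2] recursive_fn_comp1[OF f(1)]
        recursive_fn_comp1[OF g(1)]) simp_all
  moreover have "finite {i. h i = n} \<and> card {i. h i = n} \<le> k + l" if "n > 0" for n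
  proof
    show "finite {i. h i = n}" unfolding h_eq using f(2) g(2) that by blast
    have "card {i. h i = n} \<le> card ((\<lambda>n. 2 * n) ` {i. f i = n}) + card ((\<lambda>n. Suc (2 * n)) ` {i. g i = n})"
      unfolding h_eq by (rule card_Un_le)
    also have "\<dots> \<le> k + l"
      using f(2)[OF that] g(2)[OF that] by (intro add_mono) (meson card_image_le le_trans)+
    finally show "card {i. h i = n} \<le> k + l" .
  qed
  moreover have "((\<lambda>i. weight (h i)) has_sum (x + y)) UNIV"
  proof -
    have "((\<lambda>i. weight (h i)) has_sum x) (range (\<lambda>n. 2 * n))"
      by (subst has_sum_reindex) (use f(3) in \<open>auto simp: inj_on_def o_def\<close>)
    moreover have "((\<lambda>i. weight (h i)) has_sum y) (range (\<lambda>n. Suc (2 * n)))"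
      by (subst has_sum_reindex) (use g(3) in \<open>auto simp: inj_on_def o_def\<close>)
    moreover have "range (\<lambda>n. 2 * n) \<inter> range (\<lambda>n. Suc (2 * n)) = ({} :: nat set)"
      by (auto, presburger)
    ultimately show ?thesis by (subst UNIV_eq[symmetric]) (rule has_sum_Un_disjoint)
  qed
  ultimately show ?thesis unfolding coded_def by blast
qed

lemma coded_real_of_set:
  assumes "computably_enumerable A" shows "coded (real_of_set A)"
proof (cases "A = {}")
  case True
  then show ?thesis by (simp add: real_of_set_def coded_0)
next
  case False
  then obtain g where g: "computable g" "A = range g"
    using assms by (auto simp: computably_enumerable_def)
  \<comment> \<open>Only the first appearance of an element counts; repetitions become padding.
    \<open>Suc\<close> both frees the value \<open>0\<close> and matches the exponent
    \<open>n + 1\<close> in \<open>real_of_set\<close>.\<close>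
  define h where "h = (\<lambda>i. if \<exists>j<i. g j = g i then 0 else Suc (g i))"
  define I where "I = {i. \<not> (\<exists>j<i. g j = g i)}"
  have inj: "inj_on g I"
    by (auto simp: inj_on_def I_def) (metis linorder_neqE_nat)
  have "g ` I = A"
  proof (intro equalityI subsetI)
    fix a assume "a \<in> A"
    then have ex: "\<exists>i. g i = a" using g by auto
    have "(LEAST i. g i = a) \<in> I"
      unfolding I_def using LeastI_ex[OF ex] not_less_Least by auto
    then show "a \<in> g ` I" using LeastI_ex[OF ex] by force
  qed (use g in auto)
  have "computable h"
  proof -
    have "decidable 1 (\<lambda>xs. \<exists>j<xs ! 0. g j = g (xs ! 0))"
      by (intro recursive_intros recursive_fn_comp1[OF g(1)]) simp_all
    then show ?thesis unfolding computable_iff h_def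
      by (intro recursive_intros recursive_fn_comp1[OF g(1)]) simp_all
  qed
  moreover have "finite {i. h i = n} \<and> card {i. h i = n} \<le> 1" if "n > 0" for n
  proof -
    have sub: "{i. h i = n} \<subseteq> {i \<in> I. g i = n - 1}"
      using that by (auto simp: h_def I_def)
    have "i = j" if "i \<in> {i. h i = n}" "j \<in> {i. h i = n}" for i j
      using sub that inj unfolding inj_on_def by (metis (mono_tags, lifting) mem_Collect_eq subsetD)
    then obtain i where "{i. h i = n} \<subseteq> {i}" by blast
    then have "finite {i. h i = n}" "card {i. h i = n} \<le> card {i}"
      by (auto intro: finite_subset simp del: card.insert card_1_singleton_iff intro!: card_mono)
    then show ?thesis by simp
  qed
  moreover have "((\<lambda>i. weight (h i)) has_sum real_of_set A) UNIV"
  proof -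
    have "(\<lambda>n. 1 / 2 ^ (n + 1) :: real) summable_on UNIV"
    proof (rule norm_summable_imp_summable_on)
      have "summable (\<lambda>n. (1/2) * (1/2 :: real) ^ n)"
        by (intro summable_mult summable_geometric) auto
      then show "summable (\<lambda>n. norm (1 / 2 ^ (n + 1) :: real))"
        by (simp add: power_one_over field_simps)
    qed
    then have "(\<lambda>n. 1 / 2 ^ (n + 1) :: real) summable_on A"
      by (rule summable_on_subset_banach) simp
    then have "((\<lambda>n. 1 / 2 ^ (n + 1) :: real) has_sum real_of_set A) (g ` I)"
      unfolding \<open>g ` I = A\<close> real_of_set_def by (rule has_sum_infsum)
    then have "((\<lambda>i. 1 / 2 ^ (g i + 1) :: real) has_sum real_of_set A) I"
      by (subst (asm) has_sum_reindex[OF inj]) (simp add: o_def)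
    then show ?thesis
      by (subst (asm) has_sum_cong_neutral[where T = UNIV and g = "\<lambda>i. weight (h i)"])
         (auto simp: I_def h_def weight_def power_one_over)
  qed
  ultimately show ?thesis unfolding coded_def by blast
qed

lemma coded_if_regular:
  assumes "regular x" shows "coded x"
proof -
  obtain k :: nat and y where y: "\<And>i. i < k \<Longrightarrow> strongly_left_computable (y i)" and x: "x = (\<Sum>i<k. y i)"
    using assms by (auto simp: regular_def)
  have "coded (\<Sum>i<j. y i)" if "j \<le> k" for j
    using that
  proof (induction j)
    case (Suc j)
    then have "coded (y j)"
      using y[of j] coded_real_of_set by (auto simp: strongly_left_computable_def)
    with Suc show ?case by (simp add: coded_add)
  qed (simp add: coded_0)
  then show ?thesis using x by simp
qed

lemma regular_if_strongly_left_computable: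
  assumes "strongly_left_computable x" shows "regular x"
  unfolding regular_def
  by (rule exI[of _ 1], rule exI[of _ "\<lambda>_. x"]) (use assms in simp)

section \<open>Rational numbers\<close>

lemma superspeedableI:
  assumes "left_approximation q x"
    and "(\<lambda>n. (real_of_rat (q (Suc n)) - real_of_rat (q n)) / (x - real_of_rat (q n))) \<longlonglongrightarrow> 1"
  shows "superspeedable x"
proof -
  have "(\<lambda>n. ereal ((real_of_rat (q (Suc n)) - real_of_rat (q n)) / (x - real_of_rat (q n))))
      \<longlonglongrightarrow> ereal 1"
    using assms(2) by (rule tendsto_ereal)
  then have "limsup (\<lambda>n. ereal ((real_of_rat (q (Suc n)) - real_of_rat (q n)) / (x - real_of_rat (q n)))) = ereal 1"
    by (intro lim_imp_Limsup) simp_all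
  then show ?thesis unfolding superspeedable_def using assms(1) by (auto simp: one_ereal_def)
qed

text \<open>With error \<open>1 / (d * 2 ^ (n * n))\<close>, consecutive errors have ratio
  \<open>(1/2) ^ (2 * n + 1)\<close>, so the jumps cover almost everything. This serves the
  degenerate case of finitely many terms, where the partial sums stop increasing.\<close>

lemma superspeedable_nonneg_fraction:
  fixes p d :: nat
  assumes "d > 0"
  shows "superspeedable (real p / real d)"
proof (rule superspeedableI)
  define q :: "nat \<Rightarrow> rat" where "q = (\<lambda>n. of_nat p / of_nat d - 1 / of_nat (d * 2 ^ (n * n)))"
  \<comment> \<open>For \<open>p = 0\<close> every approximant is negative. Otherwise
    \<open>p * 2 ^ (n * n)\<close> is at least \<open>1\<close>, so the truncated subtraction in
    \<open>a\<close> is exact.\<close>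
  define s :: "nat \<Rightarrow> nat" where "s = (\<lambda>n. if p = 0 then 1 else 0)"
  define a :: "nat \<Rightarrow> nat" where "a = (\<lambda>n. if p = 0 then 1 else p * 2 ^ (n * n) - 1)"
  define b :: "nat \<Rightarrow> nat" where "b = (\<lambda>n. d * 2 ^ (n * n))"
  have q: "real_of_rat (q n) = real p / real d - 1 / (real d * 2 ^ (n * n))" for n
    by (simp add: q_def of_rat_diff of_rat_divide of_rat_mult of_rat_power)
  have "computable_rat_seq q"
    unfolding computable_rat_seq_def
  proof (intro exI conjI allI)
    show "computable s" unfolding computable_iff s_def by (intro recursive_intros)
    show "computable a" unfolding computable_iff a_def by (intro recursive_intros) simp_all
    show "computable b" unfolding computable_iff b_def by (intro recursive_intros) simp_all
    show "b n \<noteq> 0" for n using assms by (simp add: b_def)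
    have "of_nat (p * 2 ^ (n * n) - 1) = (of_nat p * 2 ^ (n * n) - 1 :: rat)" if "p > 0" for n
      using that by (subst of_nat_diff) auto
    then show "q n = (- 1) ^ s n * (of_nat (a n) / of_nat (b n))" for n
      using assms by (simp add: q_def s_def a_def b_def field_simps)
  qed
  moreover have "strict_mono q"
  proof (rule strict_monoI_Suc)
    fix n
    have "(2::rat) ^ (n * n) < 2 ^ (Suc n * Suc n)"
      by (intro power_strict_increasing) auto
    then show "q n < q (Suc n)"
      unfolding q_def using assms by (simp add: divide_strict_left_mono)
  qed
  moreover have "(\<lambda>n. real_of_rat (q n)) \<longlonglongrightarrow> real p / real d"
  proof -
    have "(\<lambda>n. (1/2 :: real) ^ (n * n)) \<longlonglongrightarrow> 0"
      by (rule tendsto_sandwich[of "\<lambda>_. 0" _ _ "\<lambda>n. (1/2) ^ n"])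
         (auto intro!: always_eventually power_decreasing LIMSEQ_power_zero)
    then have "(\<lambda>n. real p / real d - 1 / real d * (1/2) ^ (n * n)) \<longlonglongrightarrow> real p / real d - 1 / real d * 0"
      by (intro tendsto_intros)
    then show ?thesis by (simp add: q power_one_over)
  qed
  ultimately show "left_approximation q (real p / real d)"
    by (simp add: left_approximation_def)
  have "(real_of_rat (q (Suc n)) - real_of_rat (q n)) / (real p / real d - real_of_rat (q n))
      = 1 - 1/2 * (1/4) ^ n" for n
  proof -
    have "Suc n * Suc n = n * n + (1 + 2 * n)" by simp
    then have "(2::real) ^ (Suc n * Suc n) = 2 ^ (n * n) * (2 * 4 ^ n)"
      by (simp only: power_add power_mult) simp
    then have "real_of_rat (q (Suc n)) = real p / real d - 1 / (real d * 2 ^ (n * n)) * (1/2 * (1/4) ^ n)"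
      unfolding q by (simp add: power_one_over del: mult_Suc mult_Suc_right)
    then show ?thesis
      using assms unfolding q[of n] by (simp add: left_diff_distrib)
  qed
  moreover have "(\<lambda>n. 1 - 1/2 * (1/4 :: real) ^ n) \<longlonglongrightarrow> 1 - 1/2 * 0"
    by (intro tendsto_intros LIMSEQ_power_zero) auto
  ultimately show "(\<lambda>n. (real_of_rat (q (Suc n)) - real_of_rat (q n)) /
      (real p / real d - real_of_rat (q n))) \<longlonglongrightarrow> 1"
    by simp
qed

section \<open>Infinite dyadic series\<close>

text \<open>Padding is gone here: every index contributes a positive term, which makes the partial
  sums strictly increasing. An exponent \<open>0\<close> would stand for an ordinary term
  \<open>1\<close>.\<close>

locale dyadic_series =
  fixes u :: "nat \<Rightarrow> nat" and k :: nat and x :: real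
  assumes computable_u: "computable u"
    and finite_fibre: "\<And>n. finite {i. u i = n}"
    and card_fibre: "\<And>n. card {i. u i = n} \<le> k"
    and sums_x: "(\<lambda>i. (1/2) ^ u i) sums x"
begin

section \<open>Partial sums as computable left-approximations\<close>

definition X :: "nat \<Rightarrow> real" where "X t = (\<Sum>i<t. (1/2) ^ u i)"

text \<open>The rational copy of \<open>X\<close>, since computability is defined for rational
  sequences only.\<close>

definition Q :: "nat \<Rightarrow> rat" where "Q t = (\<Sum>i<t. (1/2) ^ u i)"

lemma of_rat_Q [simp]: "real_of_rat (Q t) = X t"
  by (simp add: Q_def X_def of_rat_sum of_rat_power of_rat_divide)

lemma X_Suc: "X (Suc t) = X t + (1/2) ^ u t"
  by (simp add: X_def)

lemma strict_mono_X: "strict_mono X"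
  by (rule strict_monoI_Suc) (simp add: X_Suc)

lemma strict_mono_Q: "strict_mono Q"
  by (rule strict_monoI_Suc) (simp add: Q_def)

lemma X_tendsto: "X \<longlonglongrightarrow> x"
  using sums_x unfolding sums_def X_def .

lemma X_less: "X t < x"
proof -
  have "X t < X (Suc t)" by (simp add: X_Suc)
  also have "X (Suc t) \<le> x"
    using X_tendsto strict_mono_X by (meson incseq_le strict_mono_mono)
  finally show ?thesis .
qed

lemma computable_rat_seq_Q: "computable_rat_seq Q"
  unfolding computable_rat_seq_def
proof (intro exI conjI allI)
  \<comment> \<open>The sum of the exponents dominates each of them, so \<open>2 ^ C t\<close> is a
    common denominator of the first \<open>t\<close> terms.\<close>
  define C where "C = (\<lambda>t. \<Sum>i<t. u i)"
  have C: "computable C"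
    unfolding computable_iff C_def
    by (intro recursive_intros recursive_fn_comp1[OF computable_u]) simp_all
  show "computable (\<lambda>_. 0)" unfolding computable_iff by (intro recursive_intros)
  show "computable (\<lambda>t. \<Sum>i<t. 2 ^ (C t - u i))"
    unfolding computable_iff
    by (intro recursive_intros recursive_fn_comp1[OF computable_u] recursive_fn_comp1[OF C]) simp_all
  show "computable (\<lambda>t. 2 ^ C t)"
    unfolding computable_iff by (intro recursive_intros recursive_fn_comp1[OF C]) simp_all
  show "2 ^ C t \<noteq> (0 :: nat)" for t by simp
  show "Q t = (- 1) ^ 0 * (of_nat (\<Sum>i<t. 2 ^ (C t - u i)) / of_nat (2 ^ C t))" for t
  proof -
    have "(1/2 :: rat) ^ u i = 2 ^ (C t - u i) / 2 ^ C t" if "i < t" for i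
    proof -
      have "u i \<le> C t" unfolding C_def using that by (intro member_le_sum) auto
      then show ?thesis by (simp add: power_diff power_one_over)
    qed
    then show ?thesis by (simp add: Q_def sum_divide_distrib)
  qed
qed

lemma left_approximation_subsequence:
  assumes "computable s" "strict_mono s"
  shows "left_approximation (\<lambda>n. Q (s n)) x"
  unfolding left_approximation_def
proof (intro conjI)
  obtain e a b where "computable e" "computable a" "computable b"
      "\<And>n. b n \<noteq> 0 \<and> Q n = (- 1) ^ e n * (of_nat (a n) / of_nat (b n))"
    using computable_rat_seq_Q by (auto simp: computable_rat_seq_def)
  then show "computable_rat_seq (\<lambda>n. Q (s n))"
    unfolding computable_rat_seq_def
    by (intro exI[of _ "\<lambda>n. e (s n)"] exI[of _ "\<lambda>n. a (s n)"] exI[of _ "\<lambda>n. b (s n)"])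
       (use assms(1) in \<open>auto simp: computable_iff[of "\<lambda>n. _ (s n)"] computable_iff[of s] intro: recursive_fn_comp1\<close>)
  show "strict_mono (\<lambda>n. Q (s n))"
    using strict_mono_Q assms(2) by (simp add: strict_mono_def)
  show "(\<lambda>n. real_of_rat (Q (s n))) \<longlonglongrightarrow> x"
    using LIMSEQ_subseq_LIMSEQ[OF X_tendsto assms(2)] by (simp add: o_def)
qed

text \<open>Grouped by exponent, the tail contains each power from \<open>(1/2) ^ n\<close> on at
  most \<open>k\<close> times, so it is bounded by \<open>k\<close> geometric series of value
  \<open>2 * (1/2) ^ n\<close>.\<close>

lemma tail_le:
  assumes "\<And>i. i \<ge> s \<Longrightarrow> n \<le> u i"
  shows "x - X s \<le> 2 * real k * (1/2) ^ n"
proof -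
  have "X t \<le> X s + 2 * real k * (1/2) ^ n" if "t \<ge> s" for t
  proof -
    \<comment> \<open>\<open>insert n\<close> keeps the maximum meaningful when
      \<open>s = t\<close>.\<close>
    define N where "N = Suc (Max (insert n (u ` {s..<t})))"
    have sub: "u ` {s..<t} \<subseteq> {n..<N}"
      using assms by (auto simp: N_def less_Suc_eq_le simp del: Max_insert intro!: Max_ge)
    have "X t - X s = (\<Sum>i\<in>{s..<t}. (1/2) ^ u i)"
      unfolding X_def using that by (metis lessThan_atLeast0 sum_diff_nat_ivl zero_le)
    also have "\<dots> = (\<Sum>j\<in>{n..<N}. \<Sum>i\<in>{i \<in> {s..<t}. u i = j}. (1/2) ^ u i)"
      by (rule sum.group[symmetric]) (use sub in auto)
    also have "\<dots> = (\<Sum>j\<in>{n..<N}. real (card {i \<in> {s..<t}. u i = j}) * (1/2) ^ j)"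
      by (intro sum.cong) auto
    also have "\<dots> \<le> (\<Sum>j\<in>{n..<N}. real k * (1/2) ^ j)"
    proof (intro sum_mono mult_right_mono)
      fix j
      have "card {i \<in> {s..<t}. u i = j} \<le> card {i. u i = j}"
        by (intro card_mono finite_fibre) auto
      with card_fibre[of j] show "real (card {i \<in> {s..<t}. u i = j}) \<le> real k" by simp
    qed auto
    also have "\<dots> = real k * (\<Sum>j\<in>{n..<N}. (1/2) ^ j)" by (simp add: sum_distrib_left)
    also have "(\<Sum>j\<in>{n..<N}. (1/2 :: real) ^ j) \<le> 2 * (1/2) ^ n"
    proof -
      have "(\<Sum>j\<in>{n..<n + l}. (1/2 :: real) ^ j) = 2 * (1/2) ^ n - 2 * (1/2) ^ (n + l)" for l
        by (induction l) auto
      from this[of "N - n"] show ?thesis by (cases "n \<le> N") auto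
    qed
    finally show ?thesis by (simp add: mult_left_mono mult.assoc)
  qed
  then have "x \<le> X s + 2 * real k * (1/2) ^ n"
    by (intro LIMSEQ_le_const2[OF X_tendsto]) auto
  then show ?thesis by simp
qed

section \<open>Gaps and counting of exponents\<close>

lemma finite_less: "finite {i. u i < n}"
proof -
  have "{i. u i < n} = (\<Union>j<n. {i. u i = j})" by auto
  then show ?thesis using finite_fibre by simp
qed

lemma card_less_le: "card {i. u i < n} \<le> k * n"
proof -
  have "{i. u i < n} = (\<Union>j<n. {i. u i = j})" by auto
  then have "card {i. u i < n} \<le> (\<Sum>j<n. card {i. u i = j})"
    by (simp add: card_UN_le)
  also have "\<dots> \<le> (\<Sum>j<n. k)" by (intro sum_mono card_fibre)
  finally show ?thesis by (simp add: mult.commute)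
qed

text \<open>
  If the jumps stay bounded away from the remaining distance, then after the last visit to
  \<open>{..b}\<close> a value just above \<open>b\<close> must still occur, since otherwise that last visit
  would have covered almost the whole remaining distance.
\<close>

lemma bounded_gaps:
  assumes "c > 0" "\<And>s. s \<ge> s0 \<Longrightarrow> c * (1/2) ^ u s \<le> x - X (Suc s)"
  obtains m where "m > 0"
    "\<And>s i. s0 \<le> s \<Longrightarrow> s \<le> i \<Longrightarrow> \<exists>j\<ge>s. u i < u j \<and> u j \<le> u i + m"
proof -
  \<comment> \<open>\<open>m\<close> is chosen so that, by \<open>tail_le\<close>, a tail with all
    exponents at least \<open>u i + m\<close> is smaller than
    \<open>c * (1/2) ^ u i\<close>.\<close>
  have "(\<lambda>m. 2 * real k * (1/2) ^ m) \<longlonglongrightarrow> 2 * real k * 0"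
    by (intro tendsto_intros LIMSEQ_power_zero) auto
  then have "\<forall>\<^sub>F m in sequentially. 2 * real k * (1/2) ^ m < c"
    using assms(1) by (intro order_tendstoD(2)[of _ 0]) auto
  then obtain m where m: "2 * real k * (1/2) ^ m < c" "m > 0"
    by (metis (mono_tags, lifting) eventually_sequentially le_add1 le_add2 less_numeral_extra(1)
        order_less_le_trans)
  show thesis
  proof (rule that)
    fix s i assume si: "s0 \<le> s" "s \<le> i"
    define L where "L = {j. s \<le> j \<and> u j \<le> u i}"
    define l where "l = Max L"
    have L: "finite L"
      by (rule finite_subset[OF _ finite_less[of "Suc (u i)"]]) (auto simp: L_def)
    have "l \<in> L" unfolding l_def using L si by (intro Max_in) (auto simp: L_def)
    then have l: "s \<le> l" "u l \<le> u i" by (auto simp: L_def)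
    have last: "u i < u j" if "l < j" for j
    proof (rule ccontr)
      assume "\<not> u i < u j"
      then have "j \<in> L" using that l by (auto simp: L_def)
      then show False using L that unfolding l_def by (metis Max_ge leD)
    qed
    show "\<exists>j\<ge>s. u i < u j \<and> u j \<le> u i + m"
    proof (rule ccontr)
      assume no: "\<not> ?thesis"
      \<comment> \<open>After \<open>l\<close> all exponents exceed \<open>u i\<close>, and the
        assumed gap pushes them beyond \<open>u i + m\<close>.\<close>
      have "u i + m \<le> u j" if "j \<ge> Suc l" for j
        using no last[of j] that l by (meson Suc_le_eq le_trans less_imp_le nat_le_linear)
      then have "x - X (Suc l) \<le> 2 * real k * (1/2) ^ (u i + m)" by (rule tail_le)
      also have "\<dots> = 2 * real k * (1/2) ^ m * (1/2) ^ u i" by (simp add: power_add)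
      also have "\<dots> < c * (1/2) ^ u i" using m by (intro mult_strict_right_mono) auto
      also have "\<dots> \<le> c * (1/2) ^ u l" using l assms(1) by (intro mult_left_mono power_decreasing) auto
      also have "\<dots> \<le> x - X (Suc l)" using l si by (intro assms(2)) simp
      finally show False by simp
    qed
  qed (rule m)
qed

definition N :: "nat \<Rightarrow> nat \<Rightarrow> nat" where "N n s = card {i. i < s \<and> u i < n}"

text \<open>This form exhibits \<open>N\<close> as recursive, whereas the total
  \<open>card {i. u i < n}\<close> is only approached from below.\<close>

lemma N_eq_sum: "N n s = (\<Sum>i<s. if u i < n then 1 else 0)"
proof -
  have "N n s = (\<Sum>i\<in>{i \<in> {..<s}. u i < n}. 1)" by (simp add: N_def)
  also have "\<dots> = (\<Sum>i<s. if u i < n then 1 else 0)" by (subst sum.inter_filter) auto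
  finally show ?thesis .
qed

lemma N_eventually_total: "\<exists>S. \<forall>s\<ge>S. N n s = card {i. u i < n}"
proof -
  have "{i. i < s \<and> u i < n} = {i. u i < n}" if "s \<ge> Suc (Max {i. u i < n})" for s
  proof -
    have "i < s" if "u i < n" for i
      using Max_ge[OF finite_less[of n], of i] that \<open>s \<ge> _\<close> by auto
    then show ?thesis by auto
  qed
  then show ?thesis unfolding N_def by (intro exI[of _ "Suc (Max {i. u i < n})"]) auto
qed

lemma total_eq: "card {i. u i < n} = N n s + card {i. s \<le> i \<and> u i < n}"
proof -
  have "{i. u i < n} = {i. i < s \<and> u i < n} \<union> {i. s \<le> i \<and> u i < n}" by auto
  moreover have "finite {i. i < s \<and> u i < n}" "finite {i. s \<le> i \<and> u i < n}"
    by (rule finite_subset[OF _ finite_less[of n]]; auto)+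
  moreover have "{i. i < s \<and> u i < n} \<inter> {i. s \<le> i \<and> u i < n} = {}" by auto
  ultimately show ?thesis unfolding N_def by (metis card_Un_disjoint)
qed

text \<open>From a remaining index of largest exponent in the current range, the gap bound leads to
  a new one at most \<open>m\<close> higher. So each widening of the range by \<open>m\<close>
  captures at least one more index.\<close>

lemma card_remaining:
  assumes gaps: "\<And>i. s \<le> i \<Longrightarrow> \<exists>j\<ge>s. u i < u j \<and> u j \<le> u i + m"
    and "s \<le> i" "u i < n"
  shows "p < card {j. s \<le> j \<and> u j < n + m * p}"
proof (induction p)
  case 0
  have "finite {j. s \<le> j \<and> u j < n}" by (rule finite_subset[OF _ finite_less[of n]]) auto
  then show ?case using assms(2,3) by (auto simp: card_gt_0_iff)
next
  case (Suc p)
  define R where "R q = {j. s \<le> j \<and> u j < n + m * q}" for q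
  have fin: "finite (R q)" for q
    unfolding R_def by (rule finite_subset[OF _ finite_less[of "n + m * q"]]) auto
  have "\<exists>j. j \<in> R p \<and> (\<forall>j'\<in>R p. u j' \<le> u j)"
  proof -
    have "R p \<noteq> {}" using Suc unfolding R_def[symmetric] by auto
    then have "Max (u ` R p) \<in> u ` R p" using fin by (intro Max_in) auto
    then obtain j where "j \<in> R p" "u j = Max (u ` R p)" by auto
    then show ?thesis using fin by (intro exI[of _ j]) auto
  qed
  then obtain j where j: "j \<in> R p" "\<And>j'. j' \<in> R p \<Longrightarrow> u j' \<le> u j" by blast
  obtain j' where j': "j' \<ge> s" "u j < u j'" "u j' \<le> u j + m"
    using gaps[of j] j by (auto simp: R_def)
  have "insert j' (R p) \<subseteq> R (Suc p)"
    using j j' by (auto simp: R_def)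
  moreover have "j' \<notin> R p" using j(2)[of j'] j'(2) by auto
  ultimately have "Suc (card (R p)) \<le> card (R (Suc p))"
    by (metis card_insert_disjoint card_mono fin)
  then show ?case using Suc by (simp add: R_def)
qed

text \<open>
  \<open>D\<close> is the limit superior of the integer parts of \<open>m \<cdot> card {i. u i < 2n} / n\<close>. A stage at
  which the count has reached \<open>D \<cdot> n\<close> leaves fewer than \<open>n / m\<close> indices below \<open>2n\<close>, and
  by the gap bound this is too few if some value below \<open>n\<close> were still to come.
\<close>

lemma settled_criterion:
  assumes "m > 0"
    and gaps: "\<And>s i. s0 \<le> s \<Longrightarrow> s \<le> i \<Longrightarrow> \<exists>j\<ge>s. u i < u j \<and> u j \<le> u i + m"
  obtains n0 D where
    "\<And>n s. n \<ge> n0 \<Longrightarrow> s \<ge> s0 \<Longrightarrow> D * n \<le> m * N (2 * n) s \<Longrightarrow> \<forall>i\<ge>s. n \<le> u i"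
    "\<And>b. \<exists>n S. n \<ge> b \<and> (\<forall>s\<ge>S. D * n \<le> m * N (2 * n) s)"
proof -
  define T where "T n = card {i. u i < 2 * n}" for n
  \<comment> \<open>\<open>P d\<close> says that the integer part of \<open>m * T n / n\<close> is
    at least \<open>d\<close> infinitely often. \<open>card_less_le\<close> bounds such
    \<open>d\<close> by \<open>2 * m * k\<close>, so a greatest one, \<open>D\<close>,
    exists.\<close>
  define P where "P d \<longleftrightarrow> (\<exists>\<^sub>\<infinity>n. d * n \<le> m * T n)" for d
  have "d \<le> 2 * m * k" if "P d" for d
  proof -
    from that have "\<exists>n>0. d * n \<le> m * T n"
      unfolding P_def INFM_nat by blast
    then obtain n where n: "n > 0" "d * n \<le> m * T n" by blast
    note n(2)
    also have "m * T n \<le> m * (k * (2 * n))" unfolding T_def by (intro mult_left_mono card_less_le) auto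
    finally have "d * n \<le> 2 * m * k * n" by (simp add: algebra_simps)
    then show ?thesis using n by simp
  qed
  moreover have "P 0" by (simp add: P_def)
  ultimately obtain D where D: "P D" "\<And>d. P d \<Longrightarrow> d \<le> D"
    by (metis GreatestI_nat Greatest_le_nat)
  then have "\<not> P (Suc D)" by fastforce
  then obtain n1 where n1: "\<And>n. n > n1 \<Longrightarrow> m * T n < Suc D * n"
    unfolding P_def INFM_nat by (auto simp: not_le)
  show thesis
  proof (rule that)
    fix n s assume n: "n \<ge> Suc n1" and s: "s \<ge> s0" and le: "D * n \<le> m * N (2 * n) s"
    show "\<forall>i\<ge>s. n \<le> u i"
    proof (rule ccontr)
      assume "\<not> ?thesis"
      then obtain i where i: "s \<le> i" "u i < n" by auto
      define r where "r = card {j. s \<le> j \<and> u j < 2 * n}"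
      \<comment> \<open>\<open>n div m\<close> climbing steps of height at most \<open>m\<close>
        stay below \<open>2 * n\<close>.\<close>
      have "n div m < card {j. s \<le> j \<and> u j < n + m * (n div m)}"
        using card_remaining[of s m i n "n div m"] gaps[OF s] i by blast
      also have "\<dots> \<le> r"
        unfolding r_def
        by (intro card_mono finite_subset[OF _ finite_less[of "2 * n"]])
           (auto intro: less_le_trans simp: mult_2)
      finally have "n div m < r" .
      then have "n < m * r" using assms(1) by (simp add: div_less_iff_less_mult mult.commute)
      moreover have "m * T n = m * N (2 * n) s + m * r"
        unfolding T_def r_def total_eq[of "2 * n" s] by (simp add: algebra_simps)
      \<comment> \<open>Adding \<open>D * n \<le> m * N (2 * n) s\<close> and
        \<open>n < m * r\<close> exceeds the bound \<open>Suc D * n\<close> on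
        \<open>m * T n\<close>.\<close>
      ultimately show False using n1[of n] n le by simp
    qed
  next
    fix b
    obtain n where n: "n > b" "D * n \<le> m * T n" using D(1) unfolding P_def INFM_nat by blast
    moreover obtain S where "\<forall>s\<ge>S. N (2 * n) s = T n"
      using N_eventually_total[of "2 * n"] unfolding T_def by blast
    ultimately show "\<exists>n S. n \<ge> b \<and> (\<forall>s\<ge>S. D * n \<le> m * N (2 * n) s)"
      by (intro exI[of _ n] exI[of _ S]) auto
  qed
qed

text \<open>\<open>n0\<close>, \<open>D\<close> and \<open>s0\<close> are merely known to exist, but
  as fixed numbers they can be built into a computable search \<open>F\<close> for a much better
  stage. Iterating \<open>F\<close> gives the fast subsequence.\<close>

lemma superspeedable_if_bounded_gaps:
  assumes "m > 0"
    and "\<And>s i. s0 \<le> s \<Longrightarrow> s \<le> i \<Longrightarrow> \<exists>j\<ge>s. u i < u j \<and> u j \<le> u i + m"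
  shows "superspeedable x"
proof -
  obtain n0 D where settled: "\<And>n s. n \<ge> n0 \<Longrightarrow> s \<ge> s0 \<Longrightarrow> D * n \<le> m * N (2 * n) s \<Longrightarrow> \<forall>i\<ge>s. n \<le> u i"
    and ex: "\<And>b. \<exists>n S. n \<ge> b \<and> (\<forall>s\<ge>S. D * n \<le> m * N (2 * n) s)"
    using settled_criterion[OF assms] by blast
  \<comment> \<open>\<open>n0\<close> makes the criterion applicable, and
    \<open>k + s + u s + 1\<close> makes the tail after \<open>t\<close> at most
    \<open>(1/2) ^ s\<close> times the jump at \<open>s\<close>. Requiring \<open>n < t\<close>
    bounds the inner search, so the condition is decidable.\<close>
  define F where "F = (\<lambda>s. LEAST t. s < t \<and> (\<exists>n<t. n0 + k + s + u s + 1 \<le> n \<and> D * n \<le> m * N (2 * n) t))"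
  have F_ex: "\<exists>t. s < t \<and> (\<exists>n<t. n0 + k + s + u s + 1 \<le> n \<and> D * n \<le> m * N (2 * n) t)" for s
  proof -
    obtain n S where "n \<ge> n0 + k + s + u s + 1" "\<forall>t\<ge>S. D * n \<le> m * N (2 * n) t" using ex by blast
    then show ?thesis by (intro exI[of _ "s + n + S + 1"] conjI exI[of _ n]) auto
  qed
  have F: "s < F s" "\<exists>n. n0 + k + s + u s + 1 \<le> n \<and> D * n \<le> m * N (2 * n) (F s)" for s
    using LeastI_ex[OF F_ex[of s]] unfolding F_def by blast+
  have F_step: "x - X (F s) \<le> (1/2) ^ s * (X (F s) - X s)" if "s \<ge> s0" for s
  proof -
    obtain n where n: "n0 + k + s + u s + 1 \<le> n" "D * n \<le> m * N (2 * n) (F s)" using F by blast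
    then have "\<forall>i\<ge>F s. n \<le> u i" using F(1)[of s] that by (intro settled) auto
    then have "x - X (F s) \<le> 2 * real k * (1/2) ^ n" by (intro tail_le) auto
    also have "\<dots> \<le> 2 * 2 ^ k * (1/2) ^ (k + s + u s + 1)"
      using n by (intro mult_mono power_decreasing) (auto simp: less_imp_le of_nat_less_two_power)
    also have "\<dots> = (1/2) ^ s * (1/2) ^ u s" by (simp add: power_add power_one_over)
    also have "\<dots> \<le> (1/2) ^ s * (X (F s) - X s)"
    proof (intro mult_left_mono)
      have "X (Suc s) \<le> X (F s)" using strict_mono_X F(1)[of s] by (simp add: strict_mono_less_eq Suc_le_eq)
      then show "(1/2) ^ u s \<le> X (F s) - X s" by (simp add: X_Suc)
    qed auto
    finally show ?thesis .
  qed
  have "computable F"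
  proof -
    have cN: "recursive_fn 2 (\<lambda>xs. N (xs ! 0) (xs ! 1))"
      unfolding N_eq_sum by (intro recursive_intros recursive_fn_comp1[OF computable_u]) simp_all
    show ?thesis unfolding F_def
      by (intro computable_Least F_ex recursive_intros recursive_fn_comp2[OF cN]
          recursive_fn_comp1[OF computable_u]) simp_all
  qed
  \<comment> \<open>Starting at \<open>s0\<close> keeps all stages where the criterion is
    valid.\<close>
  define s where "s i = (F ^^ i) s0" for i
  have s_Suc: "s (Suc i) = F (s i)" for i by (simp add: s_def)
  have mono: "strict_mono s" by (rule strict_monoI_Suc) (simp add: s_Suc F)
  have s_ge: "s i \<ge> s0" for i
    using strict_mono_less_eq[OF mono, of 0 i] by (simp add: s_def)
  have "computable s" unfolding s_def using \<open>computable F\<close> by (rule computable_iterate)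
  show ?thesis
  proof (rule superspeedableI)
    show "left_approximation (\<lambda>i. Q (s i)) x"
      by (rule left_approximation_subsequence) fact+
    have "(\<lambda>i. (X (s (Suc i)) - X (s i)) / (x - X (s i))) \<longlonglongrightarrow> 1"
    proof (rule tendsto_sandwich)
      show "\<forall>\<^sub>F i in sequentially. 1 - (1/2) ^ i \<le> (X (s (Suc i)) - X (s i)) / (x - X (s i))"
      proof (intro always_eventually allI)
        fix i
        have "x - X (s (Suc i)) \<le> (1/2) ^ s i * (X (s (Suc i)) - X (s i))"
          unfolding s_Suc by (intro F_step s_ge)
        also have "\<dots> \<le> (1/2) ^ i * (x - X (s i))"
        proof (intro mult_mono power_decreasing)
          show "i \<le> s i" using mono by (rule strict_mono_imp_increasing)
          show "0 \<le> X (s (Suc i)) - X (s i)"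
            using strict_mono_X F(1) by (simp add: strict_mono_less_eq less_imp_le s_Suc)
        qed (use X_less in \<open>auto simp: less_imp_le\<close>)
        finally have "(1 - (1/2) ^ i) * (x - X (s i)) \<le> X (s (Suc i)) - X (s i)"
          by (simp add: algebra_simps)
        then show "1 - (1/2) ^ i \<le> (X (s (Suc i)) - X (s i)) / (x - X (s i))"
          using X_less[of "s i"] by (simp add: pos_le_divide_eq)
      qed
      show "\<forall>\<^sub>F i in sequentially. (X (s (Suc i)) - X (s i)) / (x - X (s i)) \<le> 1"
        using X_less by (intro always_eventually allI) (simp add: less_imp_le)
      have "(\<lambda>i. 1 - (1/2) ^ i) \<longlonglongrightarrow> 1 - (0::real)"
        by (intro tendsto_intros LIMSEQ_power_zero) auto
      then show "(\<lambda>i. 1 - (1/2) ^ i) \<longlonglongrightarrow> (1::real)" by simp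
    qed simp
    then show "(\<lambda>i. (real_of_rat (Q (s (Suc i))) - real_of_rat (Q (s i))) / (x - real_of_rat (Q (s i)))) \<longlonglongrightarrow> 1"
      by simp
  qed
qed

text \<open>The jump quotients of the partial sums are at most \<open>1\<close>. If their limit
  superior is not \<open>1\<close>, they are eventually below some \<open>\<delta> < 1\<close>,
  which is the situation of \<open>bounded_gaps\<close>.\<close>

theorem superspeedable: "superspeedable x"
proof (cases "limsup (\<lambda>n. ereal ((X (Suc n) - X n) / (x - X n))) = 1")
  case True
  moreover have "left_approximation Q x"
    using left_approximation_subsequence[of id]
    by (simp add: strict_mono_def computable_iff recursive_fn_nth)
  ultimately show ?thesis unfolding superspeedable_def by (intro exI[of _ Q]) simp
next
  case False
  define \<rho> where "\<rho> n = (X (Suc n) - X n) / (x - X n)" for n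
  have "limsup (\<lambda>n. ereal (\<rho> n)) \<le> 1"
    using X_less by (intro Limsup_bounded always_eventually allI) (simp add: less_imp_le \<rho>_def)
  with False have "limsup (\<lambda>n. ereal (\<rho> n)) < 1" by (simp add: \<rho>_def)
  then obtain \<delta> :: real where \<delta>: "limsup (\<lambda>n. ereal (\<rho> n)) < ereal \<delta>" "ereal \<delta> < 1"
    using ereal_dense2 by blast
  then have "\<forall>\<^sub>F n in sequentially. \<rho> n < \<delta>" using Limsup_lessD by fastforce
  then obtain s0 where s0: "\<And>s. s \<ge> s0 \<Longrightarrow> \<rho> s < \<delta>" by (auto simp: eventually_sequentially)
  have "\<delta> < 1" using \<delta>(2) by simp
  have pos: "\<rho> n > 0" for n unfolding \<rho>_def using X_less[of n] by (simp add: X_Suc)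
  have "\<delta> > 0" using pos[of s0] s0[of s0] by simp
  \<comment> \<open>The constant comes from rewriting \<open>\<rho> s < \<delta>\<close> in terms of
    the distance that remains after the jump.\<close>
  have "(1 / \<delta> - 1) * (1/2) ^ u s \<le> x - X (Suc s)" if "s \<ge> s0" for s
  proof -
    have "(1/2) ^ u s \<le> \<delta> * (x - X s)"
      using s0[OF that] X_less[of s] by (simp add: \<rho>_def X_Suc pos_divide_less_eq less_imp_le)
    then have "(1/2) ^ u s / \<delta> \<le> x - X s"
      using \<open>\<delta> > 0\<close> by (simp add: pos_divide_le_eq mult.commute)
    then show ?thesis by (simp add: X_Suc algebra_simps)
  qed
  moreover have "1 / \<delta> - 1 > 0" using \<open>\<delta> > 0\<close> \<open>\<delta> < 1\<close> by simp
  ultimately obtain m where "m > 0"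
      "\<And>s i. s0 \<le> s \<Longrightarrow> s \<le> i \<Longrightarrow> \<exists>j\<ge>s. u i < u j \<and> u j \<le> u i + m"
    using bounded_gaps by blast
  then show ?thesis by (rule superspeedable_if_bounded_gaps)
qed

end

text \<open>Dropping the padding leaves either a finite sum, hence a dyadic rational, or an infinite
  series that can be reindexed computably to fit \<open>dyadic_series\<close>.\<close>

lemma superspeedable_if_coded:
  assumes "coded x" shows "superspeedable x"
proof -
  obtain h k where h: "computable h" "\<And>n. n > 0 \<Longrightarrow> finite {i. h i = n} \<and> card {i. h i = n} \<le> k"
      "((\<lambda>i. weight (h i)) has_sum x) UNIV"
    using assms by (auto simp: coded_def)
  define I where "I = {i. 0 < h i}"
  have "((\<lambda>i. weight (h i)) has_sum x) I \<longleftrightarrow> ((\<lambda>i. weight (h i)) has_sum x) UNIV"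
    by (rule has_sum_cong_neutral) (auto simp: I_def weight_def)
  moreover have "((\<lambda>i. weight (h i)) has_sum x) I \<longleftrightarrow> ((\<lambda>i. (1/2) ^ h i) has_sum x) I"
    by (rule has_sum_cong) (auto simp: I_def weight_def)
  ultimately have sum_I: "((\<lambda>i. (1/2) ^ h i) has_sum x) I" using h(3) by simp
  show ?thesis
  proof (cases "finite I")
    case True
    \<comment> \<open>\<open>2 ^ d\<close> is a common denominator; an empty \<open>I\<close> gives
      the fraction with numerator \<open>0\<close>.\<close>
    define d where "d = (\<Sum>i\<in>I. h i)"
    have "x = (\<Sum>i\<in>I. (1/2) ^ h i)"
      using sum_I has_sum_finite[OF True] has_sum_unique by blast
    also have "\<dots> = (\<Sum>i\<in>I. 2 ^ (d - h i) / 2 ^ d)"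
    proof (intro sum.cong refl)
      fix i assume "i \<in> I"
      then have "h i \<le> d" unfolding d_def using True by (intro member_le_sum) auto
      then show "(1/2 :: real) ^ h i = 2 ^ (d - h i) / 2 ^ d" by (simp add: power_diff power_one_over)
    qed
    also have "\<dots> = real (\<Sum>i\<in>I. 2 ^ (d - h i)) / real (2 ^ d)"
      by (simp add: sum_divide_distrib)
    finally show ?thesis using superspeedable_nonneg_fraction[of "2 ^ d"] by (metis zero_less_numeral zero_less_power)
  next
    case False
    \<comment> \<open>\<open>G n\<close> finds the first contributing index from \<open>n\<close>
      on; iterating it yields \<open>\<nu>\<close>, the increasing enumeration of
      \<open>I\<close>.\<close>
    define G where "G = (\<lambda>n. LEAST j. n \<le> j \<and> 0 < h j)"
    have G_ex: "\<exists>j. n \<le> j \<and> 0 < h j" for n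
      using False unfolding I_def infinite_nat_iff_unbounded_le by auto
    have G: "n \<le> G n" "0 < h (G n)" for n
      using LeastI_ex[OF G_ex[of n]] unfolding G_def by auto
    have G_le: "G n \<le> j" if "n \<le> j" "0 < h j" for n j
      unfolding G_def using that by (intro Least_le) auto
    have "computable G" unfolding G_def
      by (intro computable_Least G_ex recursive_intros recursive_fn_comp1[OF h(1)]) simp_all
    define \<nu> where "\<nu> i = ((\<lambda>n. G (Suc n)) ^^ i) (G 0)" for i
    have "computable \<nu>" unfolding \<nu>_def
      by (intro computable_iterate)
         (unfold computable_iff, intro recursive_intros recursive_fn_comp1[OF \<open>computable G\<close>], simp)
    have \<nu>_Suc: "\<nu> (Suc i) = G (Suc (\<nu> i))" for i by (simp add: \<nu>_def)
    have mono: "strict_mono \<nu>"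
      by (rule strict_monoI_Suc) (metis G(1) Suc_le_eq \<nu>_Suc)
    have pos: "0 < h (\<nu> i)" for i
      by (cases i) (simp_all add: \<nu>_Suc G, simp add: \<nu>_def G)
    have range: "range \<nu> = I"
    proof (intro equalityI subsetI)
      fix j assume j: "j \<in> I"
      \<comment> \<open>By minimality of \<open>G\<close>, a missed index would stay above every
        value of the strictly increasing \<open>\<nu>\<close>.\<close>
      show "j \<in> range \<nu>"
      proof (rule ccontr)
        assume no: "j \<notin> range \<nu>"
        have "\<nu> i < j" for i
        proof (induction i)
          case 0
          have "\<nu> 0 \<le> j" using G_le[of 0 j] j by (simp add: \<nu>_def I_def)
          then show ?case using no by (metis le_neq_implies_less rangeI)
        next
          case (Suc i)
          then have "\<nu> (Suc i) \<le> j" using G_le[of "Suc (\<nu> i)" j] j by (simp add: \<nu>_Suc I_def)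
          then show ?case using no by (metis le_neq_implies_less rangeI)
        qed
        then show False using strict_mono_imp_increasing[OF mono, of j] by (meson leD)
      qed
    qed (auto simp: I_def pos)
    have inj: "inj \<nu>" using mono by (rule strict_mono_imp_inj_on)
    \<comment> \<open>\<open>coded\<close> gives no bound over \<open>0\<close>, but without padding
      that fibre is empty.\<close>
    have fibre: "{i. h (\<nu> i) = n} = {}" if "n = 0" for n using pos that by (metis (mono_tags) empty_Collect_eq less_irrefl)
    interpret dyadic_series "\<lambda>i. h (\<nu> i)" k x
    proof
      show "computable (\<lambda>i. h (\<nu> i))"
        using recursive_fn_comp1[OF h(1)] \<open>computable \<nu>\<close> by (simp add: computable_iff[of \<nu>] computable_iff[of "\<lambda>i. h (\<nu> i)"])
      show "finite {i. h (\<nu> i) = n}" for n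
      proof (cases "n = 0")
        case False
        then have "finite (\<nu> -` {i. h i = n})" using h(2) inj by (intro finite_vimageI) auto
        then show ?thesis by (simp add: vimage_def)
      qed (simp add: fibre)
      show "card {i. h (\<nu> i) = n} \<le> k" for n
      proof (cases "n = 0")
        case False
        have "card {i. h (\<nu> i) = n} = card (\<nu> ` {i. h (\<nu> i) = n})"
          using inj by (intro card_image[symmetric]) (auto simp: inj_on_def)
        also have "\<dots> \<le> card {i. h i = n}" using h(2)[of n] False by (intro card_mono) auto
        also have "\<dots> \<le> k" using h(2)[of n] False by simp
        finally show ?thesis .
      qed (simp add: fibre)
      have "((\<lambda>i. (1/2) ^ h (\<nu> i)) has_sum x) UNIV"
        using sum_I unfolding range[symmetric] by (subst (asm) has_sum_reindex[OF inj]) (simp add: o_def)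
      then show "(\<lambda>i. (1/2) ^ h (\<nu> i)) sums x" by (rule has_sum_imp_sums)
    qed
    show ?thesis by (rule superspeedable)
  qed
qed

theorem theorem15:
  shows "(\<forall>x. regular x \<longrightarrow> superspeedable x) \<and>
         (\<forall>x. strongly_left_computable x \<longrightarrow> superspeedable x)"
  using superspeedable_if_coded coded_if_regular regular_if_strongly_left_computable by blast

end
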